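(* Let $\gamma\geqslant 1$, let $n\geqslant 3$, and let $(K_n,\omega)$ be a complete $\gamma$-polygon graph. Let $T$ be a minimal spanning tree of $(K_n,\omega)$ rooted at a vertex $x_1$, and let $C^*$ be an optimal solution to the Travelling Salesperson Problem on $(K_n,\omega)$. Then every $(T,x_1)$-shortcut $S$ satisfies $$\omega(S)\leqslant 2\gamma\,\omega(T)\leqslant 2\gamma\,\omega(C^* ).$$
   Context: Graphs are finite, simple and undirected. A complete weighted graph $(K_n,\omega)$ is the complete graph on $n$ vertices together with a weight $\omega:E(K_n)\to(0,+\infty)$. For a subgraph $F$, $\omega(F):=\sum_{e\in E(F)}\omega(e)$. Define $d$ on $V(K_n)$ by $d(x,y)=\omega(\{x,y\})$ for $x\neq y$ and $d(x,x)=0$. The graph $(K_n,\omega)$ is a $\gamma$-polygon graph (where $\gamma\geqslant 1$) if $d(z_1,z_m)\leqslant \gamma\sum_{k=1}^{m-1}d(z_k,z_{k+1})$ for all $m\in\mathbb{N}$ and all vertices $z_1,\dots,z_m$. A spanning tree of a graph $G$ is a connected acyclic subgraph $T$ with $V(T)=V(G)$; it is a minimal spanning tree if $\omega(T)$ is minimal among all spanning trees. An optimal solution to the Travelling Salesperson Problem is a Hamiltonian cycle of minimal weight $\omega$ among all Hamiltonian cycles. A tree traversal of $T$ is a walk on $T$ that traverses every edge of $T$ exactly twice. A depth-first search on $T$ started at the root $x_1$ produces a tree traversal $(x_1,\dots,x_{2n-1})$ with $x_{2n-1}=x_1$ (it depends on the choices made in the search). The shortcutting procedure crosses out of this sequence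 every entry which has already appeared earlier in the sequence, except for the final entry $x_{2n-1}=x_1$. The resulting sequence $(y_1,\dots,y_n,y_{n+1})$, with $y_1=y_{n+1}=x_1$ and $y_1,\dots,y_n$ the vertices of $K_n$ in order of first appearance, is a Hamiltonian cycle of $K_n$; any Hamiltonian cycle arising in this way is called a $(T,x_1)$-shortcut. *)

theory Defs
  imports Complex_Main
begin

record 'a ugraph =
  verts :: "'a set"
  edges :: "'a set set"

definition simple_graph :: "'a ugraph \<Rightarrow> bool" where
  "simple_graph G \<longleftrightarrow> finite (verts G) \<and>
     edges G \<subseteq> {{x, y} | x y. x \<in> verts G \<and> y \<in> verts G \<and> x \<noteq> y}"

definition complete_graph :: "'a set \<Rightarrow> 'a ugraph" where
  "complete_graph V = \<lparr>verts = V, edges = {{x, y} | x y. x \<in> V \<and> y \<in> V \<and> x \<noteq> y}\<rparr>"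

definition subgraph :: "'a ugraph \<Rightarrow> 'a ugraph \<Rightarrow> bool" where
  "subgraph H G \<longleftrightarrow> simple_graph H \<and> verts H \<subseteq> verts G \<and> edges H \<subseteq> edges G"

definition weight :: "('a set \<Rightarrow> real) \<Rightarrow> 'a ugraph \<Rightarrow> real" where
  "weight \<omega> F = (\<Sum>e\<in>edges F. \<omega> e)"

definition walk :: "'a ugraph \<Rightarrow> 'a list \<Rightarrow> bool" where
  "walk G p \<longleftrightarrow> p \<noteq> [] \<and> set p \<subseteq> verts G \<and> successively (\<lambda>x y. {x, y} \<in> edges G) p"

(* Cycles are closed vertex sequences (v1, ..., vk, v1) with k >= 3: the bound on the length
   excludes running back and forth along a single edge. *)
definition is_cycle :: "'a ugraph \<Rightarrow> 'a list \<Rightarrow> bool" where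
  "is_cycle G c \<longleftrightarrow> walk G c \<and> length c \<ge> 4 \<and> hd c = last c \<and> distinct (tl c)"

definition connected_graph :: "'a ugraph \<Rightarrow> bool" where
  "connected_graph G \<longleftrightarrow> verts G \<noteq> {} \<and>
     (\<forall>u\<in>verts G. \<forall>v\<in>verts G. \<exists>p. walk G p \<and> hd p = u \<and> last p = v)"

definition acyclic_graph :: "'a ugraph \<Rightarrow> bool" where
  "acyclic_graph G \<longleftrightarrow> (\<nexists>c. is_cycle G c)"

definition spanning_tree :: "'a ugraph \<Rightarrow> 'a ugraph \<Rightarrow> bool" where
  "spanning_tree G T \<longleftrightarrow>
     subgraph T G \<and> verts T = verts G \<and> connected_graph T \<and> acyclic_graph T"

definition min_spanning_tree :: "'a ugraph \<Rightarrow> ('a set \<Rightarrow> real) \<Rightarrow> 'a ugraph \<Rightarrow> bool" where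
  "min_spanning_tree G \<omega> T \<longleftrightarrow>
     spanning_tree G T \<and> (\<forall>T'. spanning_tree G T' \<longrightarrow> weight \<omega> T \<le> weight \<omega> T')"

definition graph_of_seq :: "'a list \<Rightarrow> 'a ugraph" where
  "graph_of_seq p = \<lparr>verts = set p, edges = {{p ! i, p ! Suc i} | i. Suc i < length p}\<rparr>"

definition hamiltonian_cycle :: "'a ugraph \<Rightarrow> 'a ugraph \<Rightarrow> bool" where
  "hamiltonian_cycle G C \<longleftrightarrow> (\<exists>c. is_cycle G c \<and> set c = verts G \<and> C = graph_of_seq c)"

definition tsp_optimal :: "'a ugraph \<Rightarrow> ('a set \<Rightarrow> real) \<Rightarrow> 'a ugraph \<Rightarrow> bool" where
  "tsp_optimal G \<omega> C \<longleftrightarrow>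
     hamiltonian_cycle G C \<and> (\<forall>C'. hamiltonian_cycle G C' \<longrightarrow> weight \<omega> C \<le> weight \<omega> C')"

(* Only the values of the weight function on edges of the complete graph are relevant. *)
definition complete_weighted_graph :: "'a set \<Rightarrow> ('a set \<Rightarrow> real) \<Rightarrow> bool" where
  "complete_weighted_graph V \<omega> \<longleftrightarrow> finite V \<and> (\<forall>e\<in>edges (complete_graph V). \<omega> e > 0)"

definition weight_dist :: "('a set \<Rightarrow> real) \<Rightarrow> 'a \<Rightarrow> 'a \<Rightarrow> real" where
  "weight_dist \<omega> x y = (if x = y then 0 else \<omega> {x, y})"

definition polygon_graph :: "real \<Rightarrow> 'a set \<Rightarrow> ('a set \<Rightarrow> real) \<Rightarrow> bool" where
  "polygon_graph \<gamma> V \<omega> \<longleftrightarrow> complete_weighted_graph V \<omega> \<and> \<gamma> \<ge> 1 \<and>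
     (\<forall>(m::nat) z. m \<ge> 1 \<longrightarrow> (\<forall>k\<in>{1..m}. z k \<in> V) \<longrightarrow>
        weight_dist \<omega> (z 1) (z m) \<le> \<gamma> * (\<Sum>k = 1..<m. weight_dist \<omega> (z k) (z (k + 1))))"

(* dfs_state G r st p: some run of depth-first search on G from r reaches a configuration with
   stack st (current vertex first, root last) after moving along the vertex sequence p.
   The visited vertices are exactly those in set p. *)
inductive dfs_state :: "'a ugraph \<Rightarrow> 'a \<Rightarrow> 'a list \<Rightarrow> 'a list \<Rightarrow> bool" for G r where
  start: "dfs_state G r [r] [r]"
| advance: "dfs_state G r (v # st) p \<Longrightarrow> {v, w} \<in> edges G \<Longrightarrow> w \<notin> set p \<Longrightarrow>
    dfs_state G r (w # v # st) (p @ [w])"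
| backtrack: "dfs_state G r (v # u # st) p \<Longrightarrow> (\<forall>w. {v, w} \<in> edges G \<longrightarrow> w \<in> set p) \<Longrightarrow>
    dfs_state G r (u # st) (p @ [u])"

definition dfs_traversal :: "'a ugraph \<Rightarrow> 'a \<Rightarrow> 'a list \<Rightarrow> bool" where
  "dfs_traversal G r p \<longleftrightarrow> dfs_state G r [r] p \<and> (\<forall>w. {r, w} \<in> edges G \<longrightarrow> w \<in> set p)"

definition shortcutting :: "'a list \<Rightarrow> 'a list" where
  "shortcutting p = nths p {i. p ! i \<notin> set (take i p) \<or> Suc i = length p}"

definition is_shortcut :: "'a ugraph \<Rightarrow> 'a \<Rightarrow> 'a ugraph \<Rightarrow> bool" where
  "is_shortcut T r S \<longleftrightarrow> (\<exists>p. dfs_traversal T r p \<and> S = graph_of_seq (shortcutting p))"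

end

theory Submission
  imports Defs "HOL-Library.Sublist"
begin

text \<open>
  While depth-first search runs, the distance walked so far plus the length of the path stored on
  the stack is twice the weight of the edges along which the search has advanced. When the stack
  has shrunk to the root, the traversal therefore has length at most twice the weight of the tree;
  shortcutting passes to a subsequence, which costs a factor of at most \<gamma>. Conversely, deleting an
  edge of an optimal tour leaves a Hamiltonian path, which is a spanning tree.
\<close>

section \<open>Lengths of vertex sequences\<close>

text \<open>Repeated steps count with multiplicity, unlike in \<open>weight\<close> of
  \<open>graph_of_seq\<close>; a traversal has to be charged for both passes over an edge.\<close>

fun seq_length :: "('a \<Rightarrow> 'a \<Rightarrow> real) \<Rightarrow> 'a list \<Rightarrow> real" where
  "seq_length d (x # y # xs) = d x y + seq_length d (y # xs)"
| "seq_length d xs = 0"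

lemma seq_length_append:
  "seq_length d (xs @ y # ys) = seq_length d (xs @ [y]) + seq_length d (y # ys)"
  by (induction xs rule: induct_list012) auto

lemma seq_length_snoc:
  assumes "xs \<noteq> []"
  shows "seq_length d (xs @ [y]) = seq_length d xs + d (last xs) y"
  using assms by (induction d xs rule: seq_length.induct) auto

text \<open>Bridge to the sum in \<open>polygon_graph\<close>, where vertices are numbered from 1
  while list positions start at 0; hence the shift \<open>k - 1\<close>.\<close>

lemma seq_length_conv_sum:
  "seq_length d xs = (\<Sum>k = 1..<length xs. d (xs ! (k - 1)) (xs ! k))"
proof (induction xs rule: rev_induct)
  case (snoc x xs)
  show ?case
  proof (cases "xs = []")
    case False
    then have "1 \<le> length xs"
      by (cases xs) auto
    then have "(\<Sum>k = 1..<length (xs @ [x]). d ((xs @ [x]) ! (k - 1)) ((xs @ [x]) ! k)) =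
        (\<Sum>k = 1..<length xs. d ((xs @ [x]) ! (k - 1)) ((xs @ [x]) ! k)) + d (last xs) x"
      using False by (auto simp: nth_append last_conv_nth)
    also have "(\<Sum>k = 1..<length xs. d ((xs @ [x]) ! (k - 1)) ((xs @ [x]) ! k)) = seq_length d xs"
      unfolding snoc by (rule sum.cong) (auto simp: nth_append)
    finally show ?thesis
      using False by (simp add: seq_length_snoc)
  qed auto
qed auto

lemma seq_length_nonneg:
  assumes "\<And>x y. x \<in> set xs \<Longrightarrow> y \<in> set xs \<Longrightarrow> 0 \<le> d x y"
  shows "0 \<le> seq_length d xs"
  using assms by (induction d xs rule: seq_length.induct) auto

text \<open>The retained vertices cut \<open>ys\<close> into stretches, and each stretch pays for
  one direct step of \<open>xs\<close> by a single polygon inequality. The stretches share no step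
  and the inequalities are not nested, so the factor stays \<gamma> instead of growing with the
  number of deletions.\<close>

lemma seq_length_subseq_le:
  assumes sub: "subseq xs ys" and V: "set ys \<subseteq> V" and "0 \<le> \<gamma>"
    and nonneg: "\<And>x y. x \<in> V \<Longrightarrow> y \<in> V \<Longrightarrow> 0 \<le> d x y"
    and polygon: "\<And>zs. zs \<noteq> [] \<Longrightarrow> set zs \<subseteq> V \<Longrightarrow> d (hd zs) (last zs) \<le> \<gamma> * seq_length d zs"
  shows "seq_length d xs \<le> \<gamma> * seq_length d ys"
  using sub V
proof (induction xs arbitrary: ys rule: induct_list012)
  case 1
  then have "0 \<le> seq_length d ys"
    using nonneg by (intro seq_length_nonneg) auto
  then show ?case
    using \<open>0 \<le> \<gamma>\<close> by simp
next
  case (2 x)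
  then have "0 \<le> seq_length d ys"
    using nonneg by (intro seq_length_nonneg) auto
  then show ?case
    using \<open>0 \<le> \<gamma>\<close> by simp
next
  case (3 x y xs)
  obtain as bs' where ys: "ys = as @ x # bs'" and "subseq (y # xs) bs'"
    using 3(3) by (blast dest: list_emb_ConsD)
  then obtain bs cs where bs': "bs' = bs @ y # cs" and "subseq xs cs"
    by (blast dest: list_emb_ConsD)
  \<comment> \<open>The induction hypothesis uses only the part of \<open>ys\<close> from
    \<open>y\<close> on, leaving the stretch from \<open>x\<close> to \<open>y\<close> to pay for
    \<open>d x y\<close>.\<close>
  have "seq_length d (y # xs) \<le> \<gamma> * seq_length d (y # cs)"
    using 3(4) ys bs' \<open>subseq xs cs\<close> by (intro 3(2)) auto
  moreover have "d x y \<le> \<gamma> * seq_length d (x # bs @ [y])"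
    using polygon[of "x # bs @ [y]"] 3(4) ys bs' by auto
  moreover have "0 \<le> seq_length d (as @ [x])"
    using 3(4) ys nonneg by (intro seq_length_nonneg) auto
  moreover have "seq_length d ys =
      seq_length d (as @ [x]) + seq_length d (x # bs @ [y]) + seq_length d (y # cs)"
    using seq_length_append[of d as x "bs @ y # cs"] seq_length_append[of d "x # bs" y cs]
    by (simp add: ys bs')
  ultimately show ?case
    using \<open>0 \<le> \<gamma>\<close> by (simp add: distrib_left) (smt (verit) mult_nonneg_nonneg)
qed

section \<open>Graphs of vertex sequences\<close>

lemma edges_graph_of_seq_Cons:
  "edges (graph_of_seq (x # y # xs)) = insert {x, y} (edges (graph_of_seq (y # xs)))"
proof (intro set_eqI iffI)
  fix e
  assume "e \<in> edges (graph_of_seq (x # y # xs))"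
  then obtain i where "e = {(x # y # xs) ! i, (x # y # xs) ! Suc i}" "Suc i < length (x # y # xs)"
    by (auto simp: graph_of_seq_def)
  then show "e \<in> insert {x, y} (edges (graph_of_seq (y # xs)))"
    by (cases i) (auto simp: graph_of_seq_def)
next
  fix e
  assume "e \<in> insert {x, y} (edges (graph_of_seq (y # xs)))"
  then consider "e = {x, y}" | i where "e = {(y # xs) ! i, (y # xs) ! Suc i}" "Suc i < length (y # xs)"
    by (auto simp: graph_of_seq_def)
  then show "e \<in> edges (graph_of_seq (x # y # xs))"
  proof cases
    case 1
    then show ?thesis
      by (auto simp: graph_of_seq_def intro!: exI[of _ 0])
  next
    case (2 i)
    then show ?thesis
      by (auto simp: graph_of_seq_def intro!: exI[of _ "Suc i"])
  qed
qed

lemma edges_graph_of_seq_Nil [simp]: "edges (graph_of_seq []) = {}"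
  and edges_graph_of_seq_singleton [simp]: "edges (graph_of_seq [x]) = {}"
  by (auto simp: graph_of_seq_def)

lemma finite_edges_graph_of_seq: "finite (edges (graph_of_seq xs))"
  by (induction xs rule: induct_list012) (auto simp: edges_graph_of_seq_Cons)

lemma edges_graph_of_seq_tl: "edges (graph_of_seq (tl xs)) \<subseteq> edges (graph_of_seq xs)"
  by (induction xs rule: induct_list012) (auto simp: edges_graph_of_seq_Cons)

text \<open>Two equal adjacent entries would contribute a singleton, which is no edge;
  \<open>distinct_adj\<close> rules this out.\<close>

lemma edges_graph_of_seq_subset:
  assumes "set xs \<subseteq> V" "distinct_adj xs"
  shows "edges (graph_of_seq xs) \<subseteq> edges (complete_graph V)"
  using assms
  by (induction xs rule: induct_list012) (auto simp: edges_graph_of_seq_Cons complete_graph_def)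

text \<open>Only an inequality, since an edge traversed repeatedly is counted once on the left.\<close>

lemma weight_graph_of_seq_le:
  assumes "complete_weighted_graph V \<omega>" "set xs \<subseteq> V" "distinct_adj xs"
  shows "weight \<omega> (graph_of_seq xs) \<le> seq_length (weight_dist \<omega>) xs"
  using assms(2,3)
proof (induction xs rule: induct_list012)
  case (3 x y xs)
  then have "x \<noteq> y" "weight \<omega> (graph_of_seq (y # xs)) \<le> seq_length (weight_dist \<omega>) (y # xs)"
    by auto
  moreover have "\<omega> {x, y} > 0"
    using 3(3) \<open>x \<noteq> y\<close> assms(1) by (auto simp: complete_weighted_graph_def complete_graph_def)
  moreover have "weight_dist \<omega> x y = \<omega> {x, y}"
    using \<open>x \<noteq> y\<close> by (simp add: weight_dist_def)
  ultimately show ?case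
    by (simp add: weight_def edges_graph_of_seq_Cons sum.insert_if finite_edges_graph_of_seq)
qed (auto simp: weight_def)

section \<open>Depth-first search and shortcuts\<close>

text \<open>The walk ends at the top of the stack, so every new step of \<open>p\<close> joins the
  two vertices that the stack operation involves.\<close>

lemma dfs_state_basic:
  assumes "dfs_state G r st p"
  shows "st \<noteq> [] \<and> p \<noteq> [] \<and> hd p = r \<and> last p = hd st \<and> set st \<subseteq> set p"
  using assms by induction auto

lemma dfs_state_verts:
  assumes "dfs_state G r st p" "r \<in> verts G" "\<Union>(edges G) \<subseteq> verts G"
  shows "set p \<subseteq> verts G"
  using assms
proof induction
  case (backtrack v u st p)
  then show ?case
    using dfs_state_basic[OF backtrack(1)] by auto
qed auto

text \<open>\<open>F\<close> collects the edges advanced along. Advancing puts the new edge on both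
  the walk and the stack path; backtracking moves the length of an edge from the stack path to the
  walk and leaves the sum unchanged.\<close>

lemma dfs_state_length:
  assumes "dfs_state G r st p"
  shows "\<exists>F \<subseteq> edges G. finite F \<and> \<Union>F \<subseteq> set p \<and>
    seq_length (weight_dist \<omega>) p + seq_length (weight_dist \<omega>) st = 2 * sum \<omega> F"
  using assms
proof induction
  case start
  then show ?case
    by (intro exI[of _ "{}"]) auto
next
  case (advance v st p w)
  note basic = dfs_state_basic[OF advance(1)]
  obtain F where F: "F \<subseteq> edges G" "finite F" "\<Union>F \<subseteq> set p"
    "seq_length (weight_dist \<omega>) p + seq_length (weight_dist \<omega>) (v # st) = 2 * sum \<omega> F"
    using advance by blast
  \<comment> \<open>All ends of edges in \<open>F\<close> are visited but \<open>w\<close> is not,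
    so the edge is new and raises \<open>sum \<omega> F\<close> by its full weight.\<close>
  have "v \<noteq> w" "{v, w} \<notin> F"
    using basic advance(3) F(3) by auto
  moreover have "weight_dist \<omega> v w = \<omega> {v, w}" "weight_dist \<omega> w v = \<omega> {v, w}"
    using \<open>v \<noteq> w\<close> by (auto simp: weight_dist_def insert_commute)
  ultimately show ?case
    using basic F advance(2)
    by (intro exI[of _ "insert {v, w} F"]) (auto simp: seq_length_snoc)
next
  case (backtrack v u st p)
  note basic = dfs_state_basic[OF backtrack(1)]
  obtain F where F: "F \<subseteq> edges G" "finite F" "\<Union>F \<subseteq> set p"
    "seq_length (weight_dist \<omega>) p + seq_length (weight_dist \<omega>) (v # u # st) = 2 * sum \<omega> F"
    using backtrack by blast
  then show ?case
    using basic
    by (intro exI[of _ F]) (auto simp: seq_length_snoc)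
qed

section \<open>First occurrences and shortcutting\<close>

lemma nths_cong:
  assumes "\<And>i. i < length xs \<Longrightarrow> i \<in> A \<longleftrightarrow> i \<in> B"
  shows "nths xs A = nths xs B"
  unfolding nths_def using assms
  by (intro arg_cong[where f = "map fst"] filter_cong) (auto simp: set_zip)

text \<open>Induction from the right fits: an appended entry does not affect earlier positions, and
  is itself kept exactly if it is new.\<close>

lemma first_occurrences:
  "distinct (nths xs {i. xs ! i \<notin> set (take i xs)}) \<and>
   set (nths xs {i. xs ! i \<notin> set (take i xs)}) = set xs"
proof (induction xs rule: rev_induct)
  case (snoc x xs)
  have "nths xs {i. (xs @ [x]) ! i \<notin> set (take i (xs @ [x]))} =
      nths xs {i. xs ! i \<notin> set (take i xs)}"
    by (rule nths_cong) (auto simp: nth_append)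
  then show ?case
    using snoc by (auto simp: nths_append)
qed auto

lemma shortcutting_snoc:
  "shortcutting (xs @ [x]) = nths xs {i. xs ! i \<notin> set (take i xs)} @ [x]"
proof -
  have "nths xs {i. (xs @ [x]) ! i \<notin> set (take i (xs @ [x])) \<or> Suc i = length (xs @ [x])} =
      nths xs {i. xs ! i \<notin> set (take i xs)}"
    by (rule nths_cong) (auto simp: nth_append)
  then show ?thesis
    by (auto simp: shortcutting_def nths_append)
qed

lemma subseq_shortcutting: "subseq (shortcutting xs) xs"
  unfolding shortcutting_def by (auto simp: subseq_conv_nths)

lemma distinct_imp_distinct_adj: "distinct xs \<Longrightarrow> distinct_adj xs"
  by (simp add: distinct_adj_altdef remdups_adj_distinct)

text \<open>First occurrences are distinct, so only the closing entry could repeat its neighbour.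
  The list of first occurrences starts with the root and contains another vertex, hence does not end
  with the root.\<close>

lemma distinct_adj_shortcutting:
  assumes "xs \<noteq> []" "hd xs = last xs" "\<not> set xs \<subseteq> {hd xs}"
  shows "distinct_adj (shortcutting xs)"
proof -
  define r where "r = last xs"
  obtain ys where xs: "xs = ys @ [r]"
    using assms(1) unfolding r_def by (metis append_butlast_last_id)
  define q where "q = nths ys {i. ys ! i \<notin> set (take i ys)}"
  have q: "distinct q" "set q = set ys"
    using first_occurrences[of ys] by (auto simp: q_def)
  obtain ys' where ys: "ys = r # ys'"
    using assms(2,3) by (cases ys) (auto simp: xs)
  obtain q' where q': "q = r # q'"
    by (simp add: q_def ys nths_Cons)
  have "q' \<noteq> []"
    using assms(3) q(2) by (auto simp: q' xs ys)
  then have "last q \<noteq> r"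
    using q(1) last_in_set[of q'] by (auto simp: q')
  then show ?thesis
    using q(1)
    by (auto simp: xs shortcutting_snoc distinct_adj_append_iff distinct_imp_distinct_adj
        simp flip: q_def)
qed

section \<open>Hamiltonian paths\<close>

lemma in_edges_graph_of_seq_index:
  assumes "distinct xs" "{xs ! i, xs ! j} \<in> edges (graph_of_seq xs)" "i < length xs" "j < length xs"
  shows "j = Suc i \<or> i = Suc j"
proof -
  obtain k where k: "{xs ! i, xs ! j} = {xs ! k, xs ! Suc k}" "Suc k < length xs"
    using assms(2) by (auto simp: graph_of_seq_def)
  then consider "xs ! i = xs ! k" "xs ! j = xs ! Suc k" | "xs ! i = xs ! Suc k" "xs ! j = xs ! k"
    by (auto simp only: doubleton_eq_iff)
  then show ?thesis
    using nth_eq_iff_index_eq[OF assms(1)] assms(3,4) k(2) by cases (auto simp del: nth_eq_iff_index_eq)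
qed

text \<open>The neighbours are the predecessor and the successor of \<open>x\<close> along the
  closed sequence; they differ because the cycle has at least three vertices.\<close>

lemma is_cycle_two_neighbours:
  assumes "is_cycle G c" "x \<in> set c"
  obtains y z where "y \<in> set c" "z \<in> set c" "y \<noteq> z" "{x, y} \<in> edges G" "{x, z} \<in> edges G"
proof -
  have E: "\<And>i. Suc i < length c \<Longrightarrow> {c ! i, c ! Suc i} \<in> edges G"
    using assms(1) by (auto simp: is_cycle_def walk_def successively_conv_nth)
  have len: "length c \<ge> 4" and "c \<noteq> []" "hd c = last c" and dist: "distinct (tl c)"
    using assms(1) by (auto simp: is_cycle_def)
  then have closed: "c ! 0 = c ! (length c - 1)"
    by (metis hd_conv_nth last_conv_nth)
  have inj: "c ! i \<noteq> c ! j" if "0 < i" "i < j" "j < length c" for i j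
    using dist that nth_eq_iff_index_eq[of "tl c" "i - 1" "j - 1"] by (simp add: nth_tl)
  obtain i where i: "i < length c" "x = c ! i"
    using assms(2) by (auto simp: in_set_conv_nth)
  \<comment> \<open>Position 0 and the last position carry the same vertex; choosing the latter
    ensures that a predecessor position exists.\<close>
  define j where "j = (if i = 0 then length c - 1 else i)"
  have j: "0 < j" "j < length c" "x = c ! j"
    using i closed len by (auto simp only: j_def split: if_splits)
  have prev: "c ! (j - 1) \<in> set c" "{x, c ! (j - 1)} \<in> edges G"
    using E[of "j - 1"] j by (auto simp: insert_commute)
  show thesis
  proof (cases "Suc j < length c")
    case True
    \<comment> \<open>For \<open>j = 1\<close> the predecessor is at position 0, outside the range
      of \<open>inj\<close>, and is read at the last position instead;
      \<open>length c \<ge> 4\<close> puts position 2 strictly before that.\<close>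
    have "c ! (j - 1) \<noteq> c ! Suc j"
    proof (cases "j = 1")
      case True
      then have "c ! Suc j \<noteq> c ! (length c - 1)"
        using inj[of 2 "length c - 1"] len by (simp add: numeral_2_eq_2)
      then show ?thesis
        using closed \<open>j = 1\<close> by simp
    next
      case False
      then show ?thesis
        using inj[of "j - 1" "Suc j"] j True by simp
    qed
    then show thesis
      using that[OF prev(1) _ _ prev(2), of "c ! Suc j"] E[OF True] j True by simp
  next
    case False
    \<comment> \<open>At the closing vertex the successor wraps around to position 1, which precedes
      \<open>j - 1\<close> strictly because \<open>length c \<ge> 4\<close>.\<close>
    then have last: "j = length c - 1"
      using j by simp
    then have "1 < j - 1"
      using len by linarith
    moreover have "j - 1 < length c"
      using j(2) by linarith
    ultimately have "c ! 1 \<noteq> c ! (j - 1)"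
      by (intro inj) simp_all
    moreover have "{x, c ! 1} \<in> edges G" "c ! 1 \<in> set c"
      using E[of 0] closed j(3) last len by simp_all
    ultimately show thesis
      using that[OF prev(1) _ _ prev(2), of "c ! 1"] by simp
  qed
qed

text \<open>The cycle vertex furthest along the path would have both its neighbours right before it.\<close>

lemma acyclic_graph_of_seq:
  assumes "distinct xs"
  shows "acyclic_graph (graph_of_seq xs)"
  unfolding acyclic_graph_def
proof
  assume "\<exists>c. is_cycle (graph_of_seq xs) c"
  then obtain c where c: "is_cycle (graph_of_seq xs) c"
    by blast
  then have sub: "set c \<subseteq> set xs" and "c \<noteq> []"
    by (auto simp: is_cycle_def walk_def graph_of_seq_def)
  define I where "I = {i. i < length xs \<and> xs ! i \<in> set c}"
  have index: "\<exists>i\<in>I. y = xs ! i" if "y \<in> set c" for y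
    using sub that by (metis (mono_tags, lifting) I_def in_set_conv_nth mem_Collect_eq subsetD)
  have "finite I"
    by (simp add: I_def)
  moreover have "I \<noteq> {}"
    using index[of "hd c"] \<open>c \<noteq> []\<close> by auto
  ultimately have m: "Max I \<in> I" and max: "\<And>i. i \<in> I \<Longrightarrow> i \<le> Max I"
    by auto
  have "xs ! Max I \<in> set c"
    using m by (simp add: I_def)
  then obtain y z where yz: "y \<in> set c" "z \<in> set c" "y \<noteq> z"
    "{xs ! Max I, y} \<in> edges (graph_of_seq xs)" "{xs ! Max I, z} \<in> edges (graph_of_seq xs)"
    using is_cycle_two_neighbours[OF c] by metis
  have before: "y = xs ! (Max I - 1)"
    if y: "y \<in> set c" "{xs ! Max I, y} \<in> edges (graph_of_seq xs)" for y
  proof -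
    obtain i where i: "i \<in> I" "y = xs ! i"
      using index y(1) by blast
    then have "i = Suc (Max I) \<or> Max I = Suc i"
      using in_edges_graph_of_seq_index[OF assms, of "Max I" i] y(2) m by (simp add: I_def)
    then have "Max I = Suc i"
      using max[OF i(1)] by linarith
    then show ?thesis
      using i(2) by simp
  qed
  show False
    using before[of y] before[of z] yz by simp
qed

lemma connected_graph_of_seq:
  assumes "xs \<noteq> []"
  shows "connected_graph (graph_of_seq xs)"
proof -
  let ?G = "graph_of_seq xs"
  \<comment> \<open>The witness is the segment of \<open>xs\<close> from position \<open>i\<close>
    to position \<open>j\<close>, both included; its reversal serves the opposite order.\<close>
  have walk: "\<exists>p. walk ?G p \<and> hd p = xs ! i \<and> last p = xs ! j"
    if "i \<le> j" "j < length xs" for i j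
  proof (intro exI[of _ "drop i (take (Suc j) xs)"] conjI)
    show "walk ?G (drop i (take (Suc j) xs))"
      using that
      by (auto simp: walk_def successively_conv_nth graph_of_seq_def dest!: in_set_dropD in_set_takeD)
  qed (use that in \<open>auto simp: hd_drop_conv_nth last_conv_nth\<close>)
  have "\<exists>p. walk ?G p \<and> hd p = u \<and> last p = v" if uv: "u \<in> verts ?G" "v \<in> verts ?G" for u v
  proof -
    obtain i j where ij: "i < length xs" "j < length xs" "u = xs ! i" "v = xs ! j"
      using uv by (auto simp: graph_of_seq_def in_set_conv_nth)
    show ?thesis
    proof (cases "i \<le> j")
      case True
      then show ?thesis
        using walk ij by blast
    next
      case False
      then obtain p where "walk ?G p" "hd p = v" "last p = u"
        using walk[of j i] ij by auto
      then show ?thesis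
        by (intro exI[of _ "rev p"]) (auto simp: walk_def hd_rev last_rev insert_commute)
    qed
  qed
  then show ?thesis
    using assms by (auto simp: connected_graph_def graph_of_seq_def)
qed

lemma spanning_tree_hamiltonian_path:
  assumes "xs \<noteq> []" "distinct xs" "set xs = V"
  shows "spanning_tree (complete_graph V) (graph_of_seq xs)"
proof -
  have verts: "verts (graph_of_seq xs) = V"
    by (simp add: graph_of_seq_def assms)
  have "edges (graph_of_seq xs) \<subseteq> edges (complete_graph V)"
    using assms by (intro edges_graph_of_seq_subset distinct_imp_distinct_adj) auto
  then show ?thesis
    using assms verts connected_graph_of_seq[of xs] acyclic_graph_of_seq[of xs]
    by (auto simp: spanning_tree_def subgraph_def simple_graph_def complete_graph_def)
qed

lemma min_spanning_tree_le_hamiltonian_cycle: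
  assumes "complete_weighted_graph V \<omega>" "min_spanning_tree (complete_graph V) \<omega> T"
    and "hamiltonian_cycle (complete_graph V) C"
  shows "weight \<omega> T \<le> weight \<omega> C"
proof -
  obtain c where c: "is_cycle (complete_graph V) c" "set c = V" "C = graph_of_seq c"
    using assms(3) by (auto simp: hamiltonian_cycle_def complete_graph_def)
  have edges: "edges C \<subseteq> edges (complete_graph V)"
    using c(1) by (auto simp: c(3) graph_of_seq_def is_cycle_def walk_def successively_conv_nth)
  have "tl c \<noteq> []"
    using c(1) by (cases c) (auto simp: is_cycle_def)
  \<comment> \<open>The first vertex recurs at the end, so passing to \<open>tl c\<close> loses no
    vertex.\<close>
  moreover have "hd c \<in> set (tl c)"
    using c(1) \<open>tl c \<noteq> []\<close> by (metis is_cycle_def last_in_set last_tl)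
  moreover have "set (tl c) = V"
    using c(2) \<open>hd c \<in> set (tl c)\<close> \<open>tl c \<noteq> []\<close> by (cases c) auto
  ultimately have "spanning_tree (complete_graph V) (graph_of_seq (tl c))"
    using c(1) by (intro spanning_tree_hamiltonian_path) (auto simp: is_cycle_def)
  then have "weight \<omega> T \<le> weight \<omega> (graph_of_seq (tl c))"
    using assms(2) by (auto simp: min_spanning_tree_def)
  \<comment> \<open>The edges of the path are among those of the cycle, and weights are
    positive.\<close>
  also have "\<dots> \<le> weight \<omega> C"
    unfolding weight_def
    using edges edges_graph_of_seq_tl[of c] assms(1) finite_edges_graph_of_seq[of c]
    by (intro sum_mono2) (auto simp: c(3) complete_weighted_graph_def less_imp_le subset_iff)
  finally show ?thesis .
qed

section \<open>The approximation guarantee\<close>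

lemma polygon_graph_seq_length:
  assumes "polygon_graph \<gamma> V \<omega>" "zs \<noteq> []" "set zs \<subseteq> V"
  shows "weight_dist \<omega> (hd zs) (last zs) \<le> \<gamma> * seq_length (weight_dist \<omega>) zs"
proof -
  have "1 \<le> length zs"
    using assms(2) by (cases zs) auto
  moreover have "\<forall>k\<in>{1..length zs}. zs ! (k - 1) \<in> V"
    using assms(3) by (auto simp: subset_iff)
  ultimately have "weight_dist \<omega> (zs ! (1 - 1)) (zs ! (length zs - 1)) \<le>
      \<gamma> * (\<Sum>k = 1..<length zs. weight_dist \<omega> (zs ! (k - 1)) (zs ! (k + 1 - 1)))"
    using assms(1)[unfolded polygon_graph_def, THEN conjunct2, THEN conjunct2, rule_format,
        of "length zs" "\<lambda>k. zs ! (k - 1)"]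
    by blast
  then show ?thesis
    using assms(2) by (simp add: seq_length_conv_sum hd_conv_nth last_conv_nth)
qed

text \<open>The first step of a walk from \<open>r\<close> to \<open>v\<close> supplies the edge. It
  serves to show that a search from the root leaves the root.\<close>

lemma connected_graph_neighbour:
  assumes "connected_graph G" "r \<in> verts G" "v \<in> verts G" "v \<noteq> r"
  obtains w where "{r, w} \<in> edges G"
proof -
  obtain p where p: "walk G p" "hd p = r" "last p = v"
    using assms by (auto simp: connected_graph_def)
  then obtain w q where "p = r # w # q"
    using assms(4) by (cases p; cases "tl p") (auto simp: walk_def)
  then show thesis
    using p(1) that by (auto simp: walk_def)
qed

lemma shortcut_weight_le:
  assumes poly: "polygon_graph \<gamma> V \<omega>" and tree: "spanning_tree (complete_graph V) T"
    and r: "r \<in> V" and "v \<in> V" "v \<noteq> r" and "is_shortcut T r S"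
  shows "weight \<omega> S \<le> 2 * \<gamma> * weight \<omega> T"
proof -
  have complete: "complete_weighted_graph V \<omega>" and "\<gamma> \<ge> 1"
    using poly by (auto simp: polygon_graph_def)
  have verts: "verts T = V" and edges: "edges T \<subseteq> edges (complete_graph V)"
    and conn: "connected_graph T"
    using tree by (auto simp: spanning_tree_def subgraph_def complete_graph_def)
  have pos: "\<omega> e > 0" if "e \<in> edges (complete_graph V)" for e
    using complete that by (simp add: complete_weighted_graph_def)
  have "edges (complete_graph V) \<subseteq> Pow V"
    by (auto simp: complete_graph_def)
  with edges have "edges T \<subseteq> Pow V"
    by (rule subset_trans)
  moreover have "finite (Pow V)"
    using complete by (simp add: complete_weighted_graph_def)
  ultimately have fin: "finite (edges T)" and sub: "\<Union>(edges T) \<subseteq> verts T"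
    using verts by (blast intro: finite_subset)+
  obtain p where p: "dfs_state T r [r] p" "\<forall>w. {r, w} \<in> edges T \<longrightarrow> w \<in> set p"
    and S: "S = graph_of_seq (shortcutting p)"
    using \<open>is_shortcut T r S\<close> by (auto simp: is_shortcut_def dfs_traversal_def)
  note basic = dfs_state_basic[OF p(1)]
  have pV: "set p \<subseteq> V"
    using dfs_state_verts[OF p(1)] r sub verts by auto
  obtain w where w: "{r, w} \<in> edges T"
    using connected_graph_neighbour[OF conn, of r v] r \<open>v \<in> V\<close> \<open>v \<noteq> r\<close> verts by auto
  \<comment> \<open>The search ends only when all neighbours of the root are visited; thus
    \<open>p\<close> contains a vertex besides \<open>r\<close>, as
    \<open>distinct_adj_shortcutting\<close> requires.\<close>
  then have "w \<noteq> r" "w \<in> set p"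
    using edges p(2) by (auto simp: complete_graph_def doubleton_eq_iff)
  then have adj: "distinct_adj (shortcutting p)"
    using basic by (intro distinct_adj_shortcutting) auto
  have nonneg: "0 \<le> weight_dist \<omega> x y" if "x \<in> V" "y \<in> V" for x y
    using pos[of "{x, y}"] that by (auto simp: weight_dist_def complete_graph_def intro!: less_imp_le)
  \<comment> \<open>At the end the stack is \<open>[r]\<close>, of length 0, so the invariant gives
    the length of the traversal alone.\<close>
  obtain F where F: "F \<subseteq> edges T" "seq_length (weight_dist \<omega>) p = 2 * sum \<omega> F"
    using dfs_state_length[OF p(1), of \<omega>] by auto
  have "sum \<omega> F \<le> weight \<omega> T"
    unfolding weight_def
    by (rule sum_mono2[OF fin F(1)]) (meson DiffD1 edges less_imp_le pos subsetD)
  have "set (shortcutting p) \<subseteq> V"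
    using pV subseq_shortcutting[of p] by (auto dest: list_emb_set)
  then have "weight \<omega> S \<le> seq_length (weight_dist \<omega>) (shortcutting p)"
    unfolding S using complete adj by (intro weight_graph_of_seq_le)
  also have "\<dots> \<le> \<gamma> * seq_length (weight_dist \<omega>) p"
    using subseq_shortcutting pV \<open>\<gamma> \<ge> 1\<close> nonneg polygon_graph_seq_length[OF poly]
    by (intro seq_length_subseq_le[where V = V]) auto
  also have "\<dots> \<le> 2 * \<gamma> * weight \<omega> T"
    using \<open>sum \<omega> F \<le> weight \<omega> T\<close> \<open>\<gamma> \<ge> 1\<close> by (simp add: F(2))
  finally show ?thesis .
qed

theorem theorem5:
  fixes V :: "'a set" and n :: nat and \<omega> :: "'a set \<Rightarrow> real" and \<gamma> :: real
    and T Cstar S :: "'a ugraph" and x1 :: 'a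
  assumes "\<gamma> \<ge> 1"
    and "n \<ge> 3"
    and "card V = n"
    and "polygon_graph \<gamma> V \<omega>"
    and "min_spanning_tree (complete_graph V) \<omega> T"
    and "x1 \<in> V"
    and "tsp_optimal (complete_graph V) \<omega> Cstar"
    and "is_shortcut T x1 S"
  shows "weight \<omega> S \<le> 2 * \<gamma> * weight \<omega> T \<and>
         2 * \<gamma> * weight \<omega> T \<le> 2 * \<gamma> * weight \<omega> Cstar"
proof
  \<comment> \<open>\<open>shortcut_weight_le\<close> asks for a second vertex besides the
    root.\<close>
  have "\<not> V \<subseteq> {x1}"
    using \<open>n \<ge> 3\<close> \<open>card V = n\<close> card_mono[of "{x1}" V] by auto
  then obtain v where "v \<in> V" "v \<noteq> x1"
    by auto
  then show "weight \<omega> S \<le> 2 * \<gamma> * weight \<omega> T"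
    using assms by (intro shortcut_weight_le) (auto simp: min_spanning_tree_def)
  have "weight \<omega> T \<le> weight \<omega> Cstar"
    using assms
    by (intro min_spanning_tree_le_hamiltonian_cycle) (auto simp: polygon_graph_def tsp_optimal_def)
  then show "2 * \<gamma> * weight \<omega> T \<le> 2 * \<gamma> * weight \<omega> Cstar"
    using \<open>\<gamma> \<ge> 1\<close> by simp
qed

end
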